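(* Let $\Bbbk$ be a commutative ring, let $A$ be a complete augmented $\Bbbk$-algebra, let $(b_i)_{i\in\mathfrak I}$ be a family of elements $b_i\in A$, and for $n\ge0$ put $\mathfrak I_n=\{i\in\mathfrak I\mid b_i\notin I(A)^n\}$. Then $(b_i)_{i\in\mathfrak I}$ is an $I$-adic basis of $A$ if and only if for every $n$ the family $(b_i)_{i\in\mathfrak I\setminus\mathfrak I_n}$ is a topological basis of $I(A)^n$.
   Context: An augmented algebra is an associative unital $\Bbbk$-algebra $A$ with an algebra homomorphism $\varepsilon_A:A\to\Bbbk$; $I(A)=\ker\varepsilon_A$, $I(A)^0=A$, and $A$ carries the $I(A)$-adic topology (subsets the subspace topology); $\Bbbk$ is discrete. $A$ is complete if the natural map $A\to\varprojlim_nA/I(A)^n$ is an isomorphism. Let $p_n:A\to A/I(A)^n$ be the projection. The index $n$ ranges over integers $n\ge 0$. $(b_i)_{i\in\mathfrak I}$ is an $I$-adic basis if, for every $n\ge0$, $(p_n(b_i))_{i\in\mathfrak I_n}$ is a basis of the $\Bbbk$-module $A/I(A)^n$. In a Hausdorff topological $\Bbbk$-module $M$, $m$ is the topological sum of a family $(m_i)_{i\in\mathfrak J}$, written $m=\sum_{i\in\mathfrak J}m_i$, if for every neighbourhood $U$ of $m$ there is a finite $\mathfrak F\subseteq\mathfrak J$ such that $\sum_{i\in\mathfrak F'}m_i\in U$ for every finite $\mathfrak F'$ with $\mathfrak F\subseteq\mathfrak F'\subseteq\mathfrak J$; the family is then called summable. A family $(b_i)_{i\in\mathfrak J}$ in $M$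 is a topological basis of $M$ if every element of $M$ can be written uniquely as $\sum_{i\in\mathfrak J}\alpha_ib_i$ with $\alpha_i\in\Bbbk$ and $(\alpha_ib_i)_{i\in\mathfrak J}$ summable.
   Formalization: The formal statement additionally assumes that the base ring is zero or that no b_i is 0; without this the claim fails, e.g. for 𝕜 = A = ℤ, ε = id and the family (1, 0), which is an I-adic basis but not a topological basis of A. *)

theory Defs
  imports
    "HOL-Algebra.Module"
    "HOL-Algebra.QuotRing"
    "HOL-Algebra.Ideal_Product"
    "HOL-Analysis.T1_Spaces"
begin

text \<open>The locale \<open>algebra\<close> of \<open>HOL-Algebra\<close> requires commutative algebras;
  here \<open>A\<close> is only associative and unital. The zero ring is allowed as base ring.\<close>

locale assoc_algebra = Module.module R A + A: ring A
  for R :: "('k, 'p) ring_scheme" (structure) and A :: "('k, 'a, 'q) module_scheme" (structure) +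
  assumes smult_mult_left:
      "\<lbrakk>r \<in> carrier R; x \<in> carrier A; y \<in> carrier A\<rbrakk> \<Longrightarrow>
        (r \<odot>\<^bsub>A\<^esub> x) \<otimes>\<^bsub>A\<^esub> y = r \<odot>\<^bsub>A\<^esub> (x \<otimes>\<^bsub>A\<^esub> y)"
    and smult_mult_right:
      "\<lbrakk>r \<in> carrier R; x \<in> carrier A; y \<in> carrier A\<rbrakk> \<Longrightarrow>
        x \<otimes>\<^bsub>A\<^esub> (r \<odot>\<^bsub>A\<^esub> y) = r \<odot>\<^bsub>A\<^esub> (x \<otimes>\<^bsub>A\<^esub> y)"

locale augmented_algebra = assoc_algebra R A
  for R :: "('k, 'p) ring_scheme" (structure) and A :: "('k, 'a, 'q) module_scheme" (structure) +
  fixes \<epsilon> :: "'a \<Rightarrow> 'k"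
  assumes augmentation_hom: "\<epsilon> \<in> ring_hom A R"
    and augmentation_smult:
      "\<lbrakk>r \<in> carrier R; x \<in> carrier A\<rbrakk> \<Longrightarrow> \<epsilon> (r \<odot>\<^bsub>A\<^esub> x) = r \<otimes>\<^bsub>R\<^esub> \<epsilon> x"

definition aug_ideal ::
  "('k, 'p) ring_scheme \<Rightarrow> ('k, 'a, 'q) module_scheme \<Rightarrow> ('a \<Rightarrow> 'k) \<Rightarrow> 'a set"
  where "aug_ideal R A \<epsilon> = a_kernel A R \<epsilon>"

primrec aug_power ::
  "('k, 'p) ring_scheme \<Rightarrow> ('k, 'a, 'q) module_scheme \<Rightarrow> ('a \<Rightarrow> 'k) \<Rightarrow> nat \<Rightarrow> 'a set"
  where
    "aug_power R A \<epsilon> 0 = carrier A"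
  | "aug_power R A \<epsilon> (Suc n) = ideal_prod A (aug_power R A \<epsilon> n) (aug_ideal R A \<epsilon>)"

definition adic_topology ::
  "('k, 'p) ring_scheme \<Rightarrow> ('k, 'a, 'q) module_scheme \<Rightarrow> ('a \<Rightarrow> 'k) \<Rightarrow> 'a topology"
  where "adic_topology R A \<epsilon> =
    topology (\<lambda>U. U \<subseteq> carrier A \<and> (\<forall>x\<in>U. \<exists>n. aug_power R A \<epsilon> n +>\<^bsub>A\<^esub> x \<subseteq> U))"

definition quot_algebra ::
  "('k, 'a, 'q) module_scheme \<Rightarrow> 'a set \<Rightarrow> ('k, 'a set) module"
  where "quot_algebra A J =
    \<lparr>carrier = carrier (A Quot J),
     mult = mult (A Quot J), one = one (A Quot J),
     zero = zero (A Quot J), add = add (A Quot J),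
     smult = (\<lambda>r X. \<Union>x\<in>X. J +>\<^bsub>A\<^esub> (r \<odot>\<^bsub>A\<^esub> x))\<rparr>"

text \<open>Compatible families of cosets: for \<open>m \<le> n\<close>, the transition map
  \<open>A / I\<^sup>n \<rightarrow> A / I\<^sup>m\<close> sends a coset \<open>X\<close> to the union of the cosets \<open>I\<^sup>m + x\<close>, \<open>x \<in> X\<close>.\<close>

definition adic_limit ::
  "('k, 'p) ring_scheme \<Rightarrow> ('k, 'a, 'q) module_scheme \<Rightarrow> ('a \<Rightarrow> 'k) \<Rightarrow> ('k, nat \<Rightarrow> 'a set) module"
  where "adic_limit R A \<epsilon> = (let Q = (\<lambda>n. quot_algebra A (aug_power R A \<epsilon> n)) in
    \<lparr>carrier = {f. (\<forall>n. f n \<in> carrier (Q n)) \<and>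
                   (\<forall>m n. m \<le> n \<longrightarrow> (\<Union>x\<in>f n. aug_power R A \<epsilon> m +>\<^bsub>A\<^esub> x) = f m)},
     mult = (\<lambda>f g n. f n \<otimes>\<^bsub>Q n\<^esub> g n), one = (\<lambda>n. \<one>\<^bsub>Q n\<^esub>),
     zero = (\<lambda>n. \<zero>\<^bsub>Q n\<^esub>), add = (\<lambda>f g n. f n \<oplus>\<^bsub>Q n\<^esub> g n),
     smult = (\<lambda>r f n. r \<odot>\<^bsub>Q n\<^esub> f n)\<rparr>)"

definition algebra_iso ::
  "('k, 'p) ring_scheme \<Rightarrow> ('k, 'a, 'q) module_scheme \<Rightarrow> ('k, 'b, 'r) module_scheme \<Rightarrow> ('a \<Rightarrow> 'b) set"
  where "algebra_iso R A B =
    {h \<in> ring_iso A B. \<forall>r\<in>carrier R. \<forall>x\<in>carrier A. h (r \<odot>\<^bsub>A\<^esub> x) = r \<odot>\<^bsub>B\<^esub> h x}"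

locale complete_augmented_algebra = augmented_algebra R A \<epsilon>
  for R :: "('k, 'p) ring_scheme" (structure) and A :: "('k, 'a, 'q) module_scheme" (structure) and \<epsilon> +
  assumes complete:
    "(\<lambda>a n. aug_power R A \<epsilon> n +>\<^bsub>A\<^esub> a) \<in> algebra_iso R A (adic_limit R A \<epsilon>)"

definition module_basis ::
  "('k, 'p) ring_scheme \<Rightarrow> ('k, 'a, 'q) module_scheme \<Rightarrow> 'i set \<Rightarrow> ('i \<Rightarrow> 'a) \<Rightarrow> bool"
  where "module_basis R M J b \<longleftrightarrow>
    b \<in> J \<rightarrow> carrier M \<and>
    (\<forall>F \<alpha>. finite F \<and> F \<subseteq> J \<and> \<alpha> \<in> F \<rightarrow> carrier R \<and>
        (\<Oplus>\<^bsub>M\<^esub>i\<in>F. \<alpha> i \<odot>\<^bsub>M\<^esub> b i) = \<zero>\<^bsub>M\<^esub> \<longrightarrow> (\<forall>i\<in>F. \<alpha> i = \<zero>\<^bsub>R\<^esub>)) \<and>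
    (\<forall>x\<in>carrier M. \<exists>F \<alpha>. finite F \<and> F \<subseteq> J \<and> \<alpha> \<in> F \<rightarrow> carrier R \<and>
        x = (\<Oplus>\<^bsub>M\<^esub>i\<in>F. \<alpha> i \<odot>\<^bsub>M\<^esub> b i))"

definition outside_power ::
  "('k, 'p) ring_scheme \<Rightarrow> ('k, 'a, 'q) module_scheme \<Rightarrow> ('a \<Rightarrow> 'k) \<Rightarrow>
    'i set \<Rightarrow> ('i \<Rightarrow> 'a) \<Rightarrow> nat \<Rightarrow> 'i set"
  where "outside_power R A \<epsilon> J b n = {i \<in> J. b i \<notin> aug_power R A \<epsilon> n}"

definition I_adic_basis ::
  "('k, 'p) ring_scheme \<Rightarrow> ('k, 'a, 'q) module_scheme \<Rightarrow> ('a \<Rightarrow> 'k) \<Rightarrow>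
    'i set \<Rightarrow> ('i \<Rightarrow> 'a) \<Rightarrow> bool"
  where "I_adic_basis R A \<epsilon> J b \<longleftrightarrow>
    (\<forall>n. module_basis R (quot_algebra A (aug_power R A \<epsilon> n))
           (outside_power R A \<epsilon> J b n) (\<lambda>i. aug_power R A \<epsilon> n +>\<^bsub>A\<^esub> b i))"

definition has_topological_sum ::
  "('k, 'a, 'q) module_scheme \<Rightarrow> 'a topology \<Rightarrow> ('i \<Rightarrow> 'a) \<Rightarrow> 'i set \<Rightarrow> 'a \<Rightarrow> bool"
  where "has_topological_sum M T x J m \<longleftrightarrow>
    x \<in> J \<rightarrow> carrier M \<and> limitin T (\<lambda>F. \<Oplus>\<^bsub>M\<^esub>i\<in>F. x i) m (finite_subsets_at_top J)"

text \<open>Coefficient families indexed by \<open>J\<close> are extensional functions, so that \<open>\<exists>!\<close>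
  only compares the coefficients at indices in \<open>J\<close>. Summability of the family
  \<open>(\<alpha>\<^sub>i b\<^sub>i)\<close> is contained in its having the sum \<open>m\<close>.\<close>

definition topological_basis_family ::
  "('k, 'p) ring_scheme \<Rightarrow> ('k, 'a, 'q) module_scheme \<Rightarrow> 'a topology \<Rightarrow>
    'i set \<Rightarrow> ('i \<Rightarrow> 'a) \<Rightarrow> bool"
  where "topological_basis_family R M T J b \<longleftrightarrow>
    b \<in> J \<rightarrow> carrier M \<and>
    (\<forall>m\<in>carrier M. \<exists>!\<alpha>. \<alpha> \<in> J \<rightarrow>\<^sub>E carrier R \<and>
        has_topological_sum M T (\<lambda>i. \<alpha> i \<odot>\<^bsub>M\<^esub> b i) J m)"

context augmented_algebra
begin

lemma ideal_aug_ideal: "ideal (aug_ideal R A \<epsilon>) A"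
proof -
  have "ring_hom_ring A R \<epsilon>"
    by (rule ring_hom_ringI2[OF A.ring_axioms R.ring_axioms augmentation_hom])
  then show ?thesis
    unfolding aug_ideal_def by (rule ring_hom_ring.kernel_is_ideal)
qed

lemma ideal_aug_power: "ideal (aug_power R A \<epsilon> n) A"
proof (induction n)
  case 0
  show ?case by (simp add: A.oneideal)
next
  case (Suc n)
  then show ?case by (simp add: A.ideal_prod_is_ideal ideal_aug_ideal)
qed

lemma aug_power_antimono: "m \<le> n \<Longrightarrow> aug_power R A \<epsilon> n \<subseteq> aug_power R A \<epsilon> m"
proof (induction n rule: dec_induct)
  case base
  show ?case by simp
next
  case (step n)
  have "aug_power R A \<epsilon> (Suc n) \<subseteq> aug_power R A \<epsilon> n"
    using A.ideal_prod_inter[OF ideal_aug_power[of n] ideal_aug_ideal] by auto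
  then show ?case using step.IH by blast
qed

lemma aug_coset_antimono:
  "m \<le> n \<Longrightarrow> aug_power R A \<epsilon> n +>\<^bsub>A\<^esub> x \<subseteq> aug_power R A \<epsilon> m +>\<^bsub>A\<^esub> x"
  using aug_power_antimono unfolding a_r_coset_def' by blast

lemma openin_adic_topology:
  "openin (adic_topology R A \<epsilon>) U \<longleftrightarrow>
    U \<subseteq> carrier A \<and> (\<forall>x\<in>U. \<exists>n. aug_power R A \<epsilon> n +>\<^bsub>A\<^esub> x \<subseteq> U)"
proof -
  have "istopology (\<lambda>U. U \<subseteq> carrier A \<and> (\<forall>x\<in>U. \<exists>n. aug_power R A \<epsilon> n +>\<^bsub>A\<^esub> x \<subseteq> U))"
    unfolding istopology_def
  proof (intro conjI allI impI ballI)
    fix S T x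
    assume S: "S \<subseteq> carrier A \<and> (\<forall>x\<in>S. \<exists>n. aug_power R A \<epsilon> n +>\<^bsub>A\<^esub> x \<subseteq> S)"
      and T: "T \<subseteq> carrier A \<and> (\<forall>x\<in>T. \<exists>n. aug_power R A \<epsilon> n +>\<^bsub>A\<^esub> x \<subseteq> T)"
    then show "S \<inter> T \<subseteq> carrier A" by blast
    assume "x \<in> S \<inter> T"
    then obtain m n where "aug_power R A \<epsilon> m +>\<^bsub>A\<^esub> x \<subseteq> S" "aug_power R A \<epsilon> n +>\<^bsub>A\<^esub> x \<subseteq> T"
      using S T by blast
    then have "aug_power R A \<epsilon> (max m n) +>\<^bsub>A\<^esub> x \<subseteq> S \<inter> T"
      using aug_coset_antimono[of m "max m n" x] aug_coset_antimono[of n "max m n" x] by auto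
    then show "\<exists>n. aug_power R A \<epsilon> n +>\<^bsub>A\<^esub> x \<subseteq> S \<inter> T" by blast
  next
    fix \<K> x
    assume "\<forall>K\<in>\<K>. K \<subseteq> carrier A \<and> (\<forall>x\<in>K. \<exists>n. aug_power R A \<epsilon> n +>\<^bsub>A\<^esub> x \<subseteq> K)"
    note K = this
    then show "\<Union> \<K> \<subseteq> carrier A" by blast
    assume "x \<in> \<Union> \<K>"
    then show "\<exists>n. aug_power R A \<epsilon> n +>\<^bsub>A\<^esub> x \<subseteq> \<Union> \<K>" using K by (meson Union_iff Union_upper subset_trans)
  qed
  then show ?thesis unfolding adic_topology_def by (simp add: topology_inverse')
qed

lemma aug_coset_subset: "x \<in> carrier A \<Longrightarrow> aug_power R A \<epsilon> n +>\<^bsub>A\<^esub> x \<subseteq> carrier A"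
  using M.a_r_coset_subset_G ideal.Icarr[OF ideal_aug_power[of n]] by (meson subsetI)

lemma topspace_adic_topology: "topspace (adic_topology R A \<epsilon>) = carrier A"
proof -
  have "openin (adic_topology R A \<epsilon>) (carrier A)"
    using openin_adic_topology aug_coset_subset by auto
  then show ?thesis
    by (metis openin_adic_topology openin_subset openin_topspace subset_antisym)
qed

lemma openin_aug_coset:
  assumes "x \<in> carrier A"
  shows "openin (adic_topology R A \<epsilon>) (aug_power R A \<epsilon> n +>\<^bsub>A\<^esub> x)"
proof -
  interpret J: ideal "aug_power R A \<epsilon> n" A by (rule ideal_aug_power)
  have "aug_power R A \<epsilon> n +>\<^bsub>A\<^esub> y = aug_power R A \<epsilon> n +>\<^bsub>A\<^esub> x"
    if "y \<in> aug_power R A \<epsilon> n +>\<^bsub>A\<^esub> x" for y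
    using M.a_repr_independence[OF that assms J.a_subgroup] by simp
  then show ?thesis
    unfolding openin_adic_topology using aug_coset_subset[OF assms] by blast
qed

end

lemma (in complete_augmented_algebra) Hausdorff_adic_topology:
  "Hausdorff_space (adic_topology R A \<epsilon>)"
  unfolding Hausdorff_space_def topspace_adic_topology
proof (intro allI impI)
  fix x y
  assume xy: "x \<in> carrier A \<and> y \<in> carrier A \<and> x \<noteq> y"
  have "inj_on (\<lambda>a n. aug_power R A \<epsilon> n +>\<^bsub>A\<^esub> a) (carrier A)"
    using complete by (auto simp: algebra_iso_def ring_iso_def bij_betw_def)
  then obtain n where n: "aug_power R A \<epsilon> n +>\<^bsub>A\<^esub> x \<noteq> aug_power R A \<epsilon> n +>\<^bsub>A\<^esub> y"
    using xy unfolding inj_on_def by blast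
  interpret J: ideal "aug_power R A \<epsilon> n" A by (rule ideal_aug_power)
  have "disjnt (aug_power R A \<epsilon> n +>\<^bsub>A\<^esub> x) (aug_power R A \<epsilon> n +>\<^bsub>A\<^esub> y)"
    using n xy M.a_repr_independence[OF _ _ J.a_subgroup] unfolding disjnt_iff by metis
  then show "\<exists>U V. openin (adic_topology R A \<epsilon>) U \<and> openin (adic_topology R A \<epsilon>) V \<and>
      x \<in> U \<and> y \<in> V \<and> disjnt U V"
    using xy openin_aug_coset J.a_rcos_self by meson
qed

end

theory Submission
  imports Defs "HOL-Algebra.UnivPoly"
begin

text \<open>Everything is reduced to congruences modulo the powers \<open>I\<^sup>k\<close>. For an \<open>I\<close>-adic basis, the
  coefficients of an element modulo \<open>I\<^sup>k\<close> are unique and hence compatible for varying \<open>k\<close>, and glue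
  to one coefficient family; every index is seen at some level \<open>k\<close>, because \<open>A\<close> is Hausdorff
  and the \<open>b\<^sub>i\<close> are nonzero. Conversely, a finite combination of the \<open>b\<^sub>i \<notin> I\<^sup>n\<close> that lies in \<open>I\<^sup>n\<close>
  is also a topological combination of the \<open>b\<^sub>i \<in> I\<^sup>n\<close>, and uniqueness of coefficients in \<open>A\<close>
  forces both to vanish.\<close>

section \<open>Finite sums and congruences modulo the powers of the augmentation ideal\<close>

text \<open>Needed because I^n enters the theorem as the record \<open>A\<close> with its carrier
  replaced, and the fold behind \<open>finsum\<close> mentions the carrier. Zero and addition are
  shared by both records, so induction on the index set identifies the sums.\<close>

lemma (in abelian_monoid) finsum_carrier_update:
  assumes "abelian_monoid (G\<lparr>carrier := H\<rparr>)" "H \<subseteq> carrier G" "finite F" "f \<in> F \<rightarrow> H"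
  shows "finsum (G\<lparr>carrier := H\<rparr>) f F = finsum G f F"
  using assms(3,4)
proof (induction F rule: finite_induct)
  case empty
  interpret H: abelian_monoid "G\<lparr>carrier := H\<rparr>" by fact
  show ?case using H.finsum_empty by simp
next
  case (insert a F)
  interpret H: abelian_monoid "G\<lparr>carrier := H\<rparr>" by fact
  have "f \<in> F \<rightarrow> carrier G" "f a \<in> carrier G"
    using insert.prems assms(2) by auto
  then show ?case
    using insert H.finsum_insert[of F a f] by (simp add: Pi_iff)
qed

context augmented_algebra
begin

lemma aug_power_closed: "x \<in> aug_power R A \<epsilon> n \<Longrightarrow> x \<in> carrier A"
  using ideal.Icarr[OF ideal_aug_power] .

lemma zero_in_aug_power: "\<zero>\<^bsub>A\<^esub> \<in> aug_power R A \<epsilon> n"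
  by (rule additive_subgroup.zero_closed[OF ideal.axioms(1)[OF ideal_aug_power]])

lemma add_in_aug_power:
  "\<lbrakk>x \<in> aug_power R A \<epsilon> n; y \<in> aug_power R A \<epsilon> n\<rbrakk> \<Longrightarrow> x \<oplus>\<^bsub>A\<^esub> y \<in> aug_power R A \<epsilon> n"
  by (rule additive_subgroup.a_closed[OF ideal.axioms(1)[OF ideal_aug_power]])

lemma uminus_in_aug_power: "x \<in> aug_power R A \<epsilon> n \<Longrightarrow> \<ominus>\<^bsub>A\<^esub> x \<in> aug_power R A \<epsilon> n"
  by (rule additive_subgroup.a_inv_closed[OF ideal.axioms(1)[OF ideal_aug_power]])

lemma minus_in_aug_power:
  "\<lbrakk>x \<in> aug_power R A \<epsilon> n; y \<in> aug_power R A \<epsilon> n\<rbrakk> \<Longrightarrow> x \<ominus>\<^bsub>A\<^esub> y \<in> aug_power R A \<epsilon> n"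
  unfolding a_minus_def by (intro add_in_aug_power uminus_in_aug_power)

text \<open>An ideal absorbs ring multiplication, so the scalar r is first turned into the ring
  element r * 1, which acts in the same way.\<close>

lemma smult_in_aug_power:
  assumes "r \<in> carrier R" "x \<in> aug_power R A \<epsilon> n"
  shows "r \<odot>\<^bsub>A\<^esub> x \<in> aug_power R A \<epsilon> n"
proof -
  have x: "x \<in> carrier A" using assms(2) by (rule aug_power_closed)
  have "(r \<odot>\<^bsub>A\<^esub> \<one>\<^bsub>A\<^esub>) \<otimes>\<^bsub>A\<^esub> x \<in> aug_power R A \<epsilon> n"
    using assms by (intro ideal.I_l_closed[OF ideal_aug_power]) auto
  then show ?thesis using smult_mult_left[of r "\<one>\<^bsub>A\<^esub>" x] assms x by simp
qed

lemma finsum_in_aug_power: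
  assumes "f \<in> F \<rightarrow> aug_power R A \<epsilon> n"
  shows "finsum A f F \<in> aug_power R A \<epsilon> n"
proof (cases "finite F")
  case True
  then show ?thesis using assms
  proof (induction F rule: finite_induct)
    case empty
    then show ?case by (simp add: zero_in_aug_power)
  next
    case (insert a F)
    have "f \<in> F \<rightarrow> carrier A" "f a \<in> carrier A"
      using insert.prems aug_power_closed by auto
    then show ?case using insert by (simp add: Pi_iff add_in_aug_power)
  qed
next
  case False
  then show ?thesis by (simp add: M.finsum_infinite zero_in_aug_power)
qed

lemma minus_aug_power_trans:
  assumes "x \<ominus>\<^bsub>A\<^esub> y \<in> aug_power R A \<epsilon> n" "y \<ominus>\<^bsub>A\<^esub> z \<in> aug_power R A \<epsilon> n"
    and "x \<in> carrier A" "y \<in> carrier A" "z \<in> carrier A"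
  shows "x \<ominus>\<^bsub>A\<^esub> z \<in> aug_power R A \<epsilon> n"
proof -
  have "(x \<ominus>\<^bsub>A\<^esub> y) \<oplus>\<^bsub>A\<^esub> (y \<ominus>\<^bsub>A\<^esub> z) = x \<ominus>\<^bsub>A\<^esub> z" using assms(3-) by algebra
  then show ?thesis using add_in_aug_power[OF assms(1,2)] by simp
qed

lemma minus_aug_power_sym:
  assumes "x \<ominus>\<^bsub>A\<^esub> y \<in> aug_power R A \<epsilon> n" "x \<in> carrier A" "y \<in> carrier A"
  shows "y \<ominus>\<^bsub>A\<^esub> x \<in> aug_power R A \<epsilon> n"
proof -
  have "\<ominus>\<^bsub>A\<^esub> (x \<ominus>\<^bsub>A\<^esub> y) = y \<ominus>\<^bsub>A\<^esub> x" using assms(2-) by algebra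
  then show ?thesis using uminus_in_aug_power[OF assms(1)] by simp
qed

lemma minus_aug_power_iff:
  assumes "x \<ominus>\<^bsub>A\<^esub> y \<in> aug_power R A \<epsilon> n" "x \<in> carrier A" "y \<in> carrier A"
  shows "x \<in> aug_power R A \<epsilon> n \<longleftrightarrow> y \<in> aug_power R A \<epsilon> n"
proof -
  have "(x \<ominus>\<^bsub>A\<^esub> y) \<oplus>\<^bsub>A\<^esub> y = x" "x \<ominus>\<^bsub>A\<^esub> (x \<ominus>\<^bsub>A\<^esub> y) = y" using assms(2-) by algebra+
  then show ?thesis
    using add_in_aug_power[OF assms(1), of y] minus_in_aug_power[OF _ assms(1), of x] by auto
qed

lemma mem_aug_coset_iff:
  assumes "x \<in> carrier A" "y \<in> carrier A"
  shows "y \<in> aug_power R A \<epsilon> n +>\<^bsub>A\<^esub> x \<longleftrightarrow> y \<ominus>\<^bsub>A\<^esub> x \<in> aug_power R A \<epsilon> n"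
proof
  assume "y \<in> aug_power R A \<epsilon> n +>\<^bsub>A\<^esub> x"
  then obtain h where h: "h \<in> aug_power R A \<epsilon> n" "y = h \<oplus>\<^bsub>A\<^esub> x"
    by (auto simp: a_r_coset_def')
  then have "h \<in> carrier A" by (simp add: aug_power_closed)
  then have "y \<ominus>\<^bsub>A\<^esub> x = h" using assms(1) unfolding h(2) by algebra
  then show "y \<ominus>\<^bsub>A\<^esub> x \<in> aug_power R A \<epsilon> n" using h by simp
next
  assume *: "y \<ominus>\<^bsub>A\<^esub> x \<in> aug_power R A \<epsilon> n"
  have "y = (y \<ominus>\<^bsub>A\<^esub> x) \<oplus>\<^bsub>A\<^esub> x" using assms by algebra
  then show "y \<in> aug_power R A \<epsilon> n +>\<^bsub>A\<^esub> x" using * by (auto simp: a_r_coset_def')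
qed

text \<open>The passage from cosets to congruences, which is the form used in the rest of the
  proof.\<close>

lemma aug_coset_eq_iff:
  assumes "x \<in> carrier A" "y \<in> carrier A"
  shows "aug_power R A \<epsilon> n +>\<^bsub>A\<^esub> y = aug_power R A \<epsilon> n +>\<^bsub>A\<^esub> x \<longleftrightarrow> y \<ominus>\<^bsub>A\<^esub> x \<in> aug_power R A \<epsilon> n"
proof -
  interpret J: ideal "aug_power R A \<epsilon> n" A by (rule ideal_aug_power)
  show ?thesis
    using mem_aug_coset_iff[OF assms] M.a_repr_independence[OF _ assms(1) J.a_subgroup, of y]
      J.a_rcos_self[OF assms(2)] by metis
qed

lemma finsum_minus:
  assumes "finite F" "f \<in> F \<rightarrow> carrier A" "g \<in> F \<rightarrow> carrier A"
  shows "(\<Oplus>\<^bsub>A\<^esub>i\<in>F. f i \<ominus>\<^bsub>A\<^esub> g i) = finsum A f F \<ominus>\<^bsub>A\<^esub> finsum A g F"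
  using assms
proof (induction F rule: finite_induct)
  case empty
  then show ?case by (simp add: a_minus_def)
next
  case (insert a F)
  have c: "f a \<in> carrier A" "g a \<in> carrier A" "finsum A f F \<in> carrier A" "finsum A g F \<in> carrier A"
    using insert.prems by (auto intro: M.finsum_closed)
  have "(\<Oplus>\<^bsub>A\<^esub>i\<in>insert a F. f i \<ominus>\<^bsub>A\<^esub> g i)
      = (f a \<ominus>\<^bsub>A\<^esub> g a) \<oplus>\<^bsub>A\<^esub> (finsum A f F \<ominus>\<^bsub>A\<^esub> finsum A g F)"
    using insert by (simp add: Pi_iff)
  also have "\<dots> = (f a \<oplus>\<^bsub>A\<^esub> finsum A f F) \<ominus>\<^bsub>A\<^esub> (g a \<oplus>\<^bsub>A\<^esub> finsum A g F)"
    using c by algebra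
  finally show ?case using insert by (simp add: Pi_iff)
qed

lemma finsum_cong_aug_power:
  assumes "finite F" "f \<in> F \<rightarrow> carrier A" "g \<in> F \<rightarrow> carrier A"
    and "\<And>i. i \<in> F \<Longrightarrow> f i \<ominus>\<^bsub>A\<^esub> g i \<in> aug_power R A \<epsilon> n"
  shows "finsum A f F \<ominus>\<^bsub>A\<^esub> finsum A g F \<in> aug_power R A \<epsilon> n"
  unfolding finsum_minus[OF assms(1-3), symmetric]
  using assms(4) by (intro finsum_in_aug_power) auto

lemma finsum_lincomb_minus:
  assumes "finite F" "\<alpha> \<in> F \<rightarrow> carrier R" "\<beta> \<in> F \<rightarrow> carrier R" "b \<in> F \<rightarrow> carrier A"
  shows "(\<Oplus>\<^bsub>A\<^esub>i\<in>F. (\<alpha> i \<ominus>\<^bsub>R\<^esub> \<beta> i) \<odot>\<^bsub>A\<^esub> b i)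
    = (\<Oplus>\<^bsub>A\<^esub>i\<in>F. \<alpha> i \<odot>\<^bsub>A\<^esub> b i) \<ominus>\<^bsub>A\<^esub> (\<Oplus>\<^bsub>A\<^esub>i\<in>F. \<beta> i \<odot>\<^bsub>A\<^esub> b i)"
proof -
  have "(\<Oplus>\<^bsub>A\<^esub>i\<in>F. (\<alpha> i \<ominus>\<^bsub>R\<^esub> \<beta> i) \<odot>\<^bsub>A\<^esub> b i) = (\<Oplus>\<^bsub>A\<^esub>i\<in>F. \<alpha> i \<odot>\<^bsub>A\<^esub> b i \<ominus>\<^bsub>A\<^esub> \<beta> i \<odot>\<^bsub>A\<^esub> b i)"
    using assms
    by (intro M.finsum_cong') (auto simp: a_minus_def Pi_iff smult_l_distr smult_l_minus)
  also have "\<dots> = (\<Oplus>\<^bsub>A\<^esub>i\<in>F. \<alpha> i \<odot>\<^bsub>A\<^esub> b i) \<ominus>\<^bsub>A\<^esub> (\<Oplus>\<^bsub>A\<^esub>i\<in>F. \<beta> i \<odot>\<^bsub>A\<^esub> b i)"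
    using assms by (intro finsum_minus) auto
  finally show ?thesis .
qed

lemma abelian_monoid_aug_power: "abelian_monoid (A\<lparr>carrier := aug_power R A \<epsilon> n\<rparr>)"
  by (rule abelian_monoidI)
    (auto simp: zero_in_aug_power add_in_aug_power aug_power_closed M.a_ac)

lemma finsum_aug_power:
  assumes "finite F" "f \<in> F \<rightarrow> aug_power R A \<epsilon> n"
  shows "finsum (A\<lparr>carrier := aug_power R A \<epsilon> n\<rparr>) f F = finsum A f F"
  using assms
  by (intro M.finsum_carrier_update abelian_monoid_aug_power) (auto intro: aug_power_closed)

section \<open>Linear combinations and bases in the quotients A / I^n\<close>

text \<open>The scalar action on the quotient is encoded as a union over all representatives. Two
  representatives differ by an element of I^n, hence so do their multiples by r; the union is
  therefore one of equal cosets over a nonempty index set.\<close>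

lemma smult_quot_algebra:
  assumes "r \<in> carrier R" "x \<in> carrier A"
  shows "r \<odot>\<^bsub>quot_algebra A (aug_power R A \<epsilon> n)\<^esub> (aug_power R A \<epsilon> n +>\<^bsub>A\<^esub> x)
    = aug_power R A \<epsilon> n +>\<^bsub>A\<^esub> (r \<odot>\<^bsub>A\<^esub> x)"
proof -
  interpret J: ideal "aug_power R A \<epsilon> n" A by (rule ideal_aug_power)
  have eq: "aug_power R A \<epsilon> n +>\<^bsub>A\<^esub> (r \<odot>\<^bsub>A\<^esub> y) = aug_power R A \<epsilon> n +>\<^bsub>A\<^esub> (r \<odot>\<^bsub>A\<^esub> x)"
    if y: "y \<in> aug_power R A \<epsilon> n +>\<^bsub>A\<^esub> x" for y
  proof -
    have yA: "y \<in> carrier A" using y aug_coset_subset[OF assms(2)] by blast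
    have "r \<odot>\<^bsub>A\<^esub> y \<ominus>\<^bsub>A\<^esub> r \<odot>\<^bsub>A\<^esub> x = r \<odot>\<^bsub>A\<^esub> (y \<ominus>\<^bsub>A\<^esub> x)"
      using assms yA by (simp add: a_minus_def smult_r_distr smult_r_minus)
    then show ?thesis
      using y assms yA by (simp add: aug_coset_eq_iff mem_aug_coset_iff smult_in_aug_power)
  qed
  have "r \<odot>\<^bsub>quot_algebra A (aug_power R A \<epsilon> n)\<^esub> (aug_power R A \<epsilon> n +>\<^bsub>A\<^esub> x)
      = (\<Union>y\<in>aug_power R A \<epsilon> n +>\<^bsub>A\<^esub> x. aug_power R A \<epsilon> n +>\<^bsub>A\<^esub> (r \<odot>\<^bsub>A\<^esub> y))"
    by (simp add: quot_algebra_def)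
  also have "\<dots> = (\<Union>y\<in>aug_power R A \<epsilon> n +>\<^bsub>A\<^esub> x. aug_power R A \<epsilon> n +>\<^bsub>A\<^esub> (r \<odot>\<^bsub>A\<^esub> x))"
    by (rule SUP_cong[OF refl eq])
  also have "\<dots> = aug_power R A \<epsilon> n +>\<^bsub>A\<^esub> (r \<odot>\<^bsub>A\<^esub> x)"
    using J.a_rcos_self[OF assms(2)] by (intro UN_constant_eq) auto
  finally show ?thesis .
qed

lemma finsum_quot_algebra:
  assumes "finite F" "f \<in> F \<rightarrow> carrier A"
  shows "(\<Oplus>\<^bsub>quot_algebra A (aug_power R A \<epsilon> n)\<^esub>i\<in>F. aug_power R A \<epsilon> n +>\<^bsub>A\<^esub> f i)
    = aug_power R A \<epsilon> n +>\<^bsub>A\<^esub> finsum A f F"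
proof -
  interpret J: ideal "aug_power R A \<epsilon> n" A by (rule ideal_aug_power)
  interpret h: ring_hom_ring A "A Quot aug_power R A \<epsilon> n" "(+>\<^bsub>A\<^esub>) (aug_power R A \<epsilon> n)"
    by (rule J.rcos_ring_hom_ring)
  \<comment> \<open>A finite sum depends on the carrier, addition and zero of the record, and these
    are copied from the factor ring. The sum can thus be taken where the projection is a ring
    homomorphism.\<close>
  have eq: "finsum (quot_algebra A (aug_power R A \<epsilon> n)) = finsum (A Quot aug_power R A \<epsilon> n)"
    by (simp add: finsum_def finprod_def quot_algebra_def fun_eq_iff)
  show ?thesis unfolding eq using h.hom_finsum[OF assms(2)] by (simp add: o_def)
qed

lemma finsum_lincomb_quot_algebra:
  assumes "finite F" "\<alpha> \<in> F \<rightarrow> carrier R" "b \<in> F \<rightarrow> carrier A"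
  shows "(\<Oplus>\<^bsub>quot_algebra A (aug_power R A \<epsilon> n)\<^esub>i\<in>F.
        \<alpha> i \<odot>\<^bsub>quot_algebra A (aug_power R A \<epsilon> n)\<^esub> (aug_power R A \<epsilon> n +>\<^bsub>A\<^esub> b i))
    = aug_power R A \<epsilon> n +>\<^bsub>A\<^esub> (\<Oplus>\<^bsub>A\<^esub>i\<in>F. \<alpha> i \<odot>\<^bsub>A\<^esub> b i)"
proof -
  interpret J: ideal "aug_power R A \<epsilon> n" A by (rule ideal_aug_power)
  interpret Q: ring "A Quot aug_power R A \<epsilon> n" by (rule J.quotient_is_ring)
  have eq: "finsum (quot_algebra A (aug_power R A \<epsilon> n)) = finsum (A Quot aug_power R A \<epsilon> n)"
    by (simp add: finsum_def finprod_def quot_algebra_def fun_eq_iff)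
  have "(\<Oplus>\<^bsub>quot_algebra A (aug_power R A \<epsilon> n)\<^esub>i\<in>F.
        \<alpha> i \<odot>\<^bsub>quot_algebra A (aug_power R A \<epsilon> n)\<^esub> (aug_power R A \<epsilon> n +>\<^bsub>A\<^esub> b i))
    = (\<Oplus>\<^bsub>quot_algebra A (aug_power R A \<epsilon> n)\<^esub>i\<in>F. aug_power R A \<epsilon> n +>\<^bsub>A\<^esub> (\<alpha> i \<odot>\<^bsub>A\<^esub> b i))"
    unfolding eq using assms
    by (intro Q.finsum_cong') (auto simp: smult_quot_algebra Pi_iff FactRing_def A_RCOSETS_def')
  also have "\<dots> = aug_power R A \<epsilon> n +>\<^bsub>A\<^esub> (\<Oplus>\<^bsub>A\<^esub>i\<in>F. \<alpha> i \<odot>\<^bsub>A\<^esub> b i)"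
    using assms by (intro finsum_quot_algebra) auto
  finally show ?thesis .
qed

lemma aug_coset_eq_zero_iff:
  assumes "x \<in> carrier A"
  shows "aug_power R A \<epsilon> n +>\<^bsub>A\<^esub> x = \<zero>\<^bsub>quot_algebra A (aug_power R A \<epsilon> n)\<^esub> \<longleftrightarrow> x \<in> aug_power R A \<epsilon> n"
proof -
  \<comment> \<open>The zero of the factor ring is the set I^n itself; it has to be seen as the
    coset of zero before cosets can be compared.\<close>
  have "\<zero>\<^bsub>quot_algebra A (aug_power R A \<epsilon> n)\<^esub> = aug_power R A \<epsilon> n +>\<^bsub>A\<^esub> \<zero>\<^bsub>A\<^esub>"
    by (simp add: quot_algebra_def FactRing_def a_r_coset_def' aug_power_closed
        set_eq_iff Bex_def cong: conj_cong)
  then show ?thesis using assms aug_coset_eq_iff[of "\<zero>\<^bsub>A\<^esub>" x n] by (simp add: a_minus_def)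
qed

text \<open>Cosets disappear here: the projection commutes with finite combinations, so independence
  and spanning in the quotient become statements about finite sums in A modulo I^n.\<close>

lemma module_basis_quot_algebra_iff:
  assumes b: "b \<in> J \<rightarrow> carrier A"
  shows "module_basis R (quot_algebra A (aug_power R A \<epsilon> n)) J (\<lambda>i. aug_power R A \<epsilon> n +>\<^bsub>A\<^esub> b i) \<longleftrightarrow>
    (\<forall>F \<alpha>. finite F \<and> F \<subseteq> J \<and> \<alpha> \<in> F \<rightarrow> carrier R \<and>
        (\<Oplus>\<^bsub>A\<^esub>i\<in>F. \<alpha> i \<odot>\<^bsub>A\<^esub> b i) \<in> aug_power R A \<epsilon> n \<longrightarrow> (\<forall>i\<in>F. \<alpha> i = \<zero>\<^bsub>R\<^esub>)) \<and>
    (\<forall>x\<in>carrier A. \<exists>F \<alpha>. finite F \<and> F \<subseteq> J \<and> \<alpha> \<in> F \<rightarrow> carrier R \<and>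
        x \<ominus>\<^bsub>A\<^esub> (\<Oplus>\<^bsub>A\<^esub>i\<in>F. \<alpha> i \<odot>\<^bsub>A\<^esub> b i) \<in> aug_power R A \<epsilon> n)"
proof -
  let ?P = "aug_power R A \<epsilon> n" and ?Q = "quot_algebra A (aug_power R A \<epsilon> n)"
  let ?s = "\<lambda>\<alpha> F. \<Oplus>\<^bsub>A\<^esub>i\<in>F. \<alpha> i \<odot>\<^bsub>A\<^esub> b i"
  let ?q = "\<lambda>\<alpha> F. \<Oplus>\<^bsub>?Q\<^esub>i\<in>F. \<alpha> i \<odot>\<^bsub>?Q\<^esub> (?P +>\<^bsub>A\<^esub> b i)"
  have carr: "carrier ?Q = (\<lambda>x. ?P +>\<^bsub>A\<^esub> x) ` carrier A"
    by (auto simp: quot_algebra_def FactRing_def A_RCOSETS_def')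
  have bF: "b \<in> F \<rightarrow> carrier A" if "F \<subseteq> J" for F using b that by auto
  have s: "?s \<alpha> F \<in> carrier A" if "finite F \<and> F \<subseteq> J \<and> \<alpha> \<in> F \<rightarrow> carrier R" for F \<alpha>
    using that bF[of F] by (intro M.finsum_closed) (auto simp: Pi_iff)
  have q: "?q \<alpha> F = ?P +>\<^bsub>A\<^esub> ?s \<alpha> F" if "finite F \<and> F \<subseteq> J \<and> \<alpha> \<in> F \<rightarrow> carrier R" for F \<alpha>
    using that bF[of F] by (intro finsum_lincomb_quot_algebra) auto
  have z: "?q \<alpha> F = \<zero>\<^bsub>?Q\<^esub> \<longleftrightarrow> ?s \<alpha> F \<in> ?P" if "finite F \<and> F \<subseteq> J \<and> \<alpha> \<in> F \<rightarrow> carrier R" for F \<alpha>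
    using q[OF that] aug_coset_eq_zero_iff[OF s[OF that]] by simp
  have e: "?P +>\<^bsub>A\<^esub> x = ?q \<alpha> F \<longleftrightarrow> x \<ominus>\<^bsub>A\<^esub> ?s \<alpha> F \<in> ?P"
    if "finite F \<and> F \<subseteq> J \<and> \<alpha> \<in> F \<rightarrow> carrier R" "x \<in> carrier A" for F \<alpha> x
    using q[OF that(1)] aug_coset_eq_iff[OF s[OF that(1)] that(2)] by simp
  have 1: "(\<lambda>i. ?P +>\<^bsub>A\<^esub> b i) \<in> J \<rightarrow> carrier ?Q" using b carr by auto
  have 2: "(\<forall>F \<alpha>. finite F \<and> F \<subseteq> J \<and> \<alpha> \<in> F \<rightarrow> carrier R \<and> ?q \<alpha> F = \<zero>\<^bsub>?Q\<^esub> \<longrightarrow> (\<forall>i\<in>F. \<alpha> i = \<zero>\<^bsub>R\<^esub>)) \<longleftrightarrow>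
    (\<forall>F \<alpha>. finite F \<and> F \<subseteq> J \<and> \<alpha> \<in> F \<rightarrow> carrier R \<and> ?s \<alpha> F \<in> ?P \<longrightarrow> (\<forall>i\<in>F. \<alpha> i = \<zero>\<^bsub>R\<^esub>))"
    using z by blast
  have 3: "(\<forall>x\<in>carrier ?Q. \<exists>F \<alpha>. finite F \<and> F \<subseteq> J \<and> \<alpha> \<in> F \<rightarrow> carrier R \<and> x = ?q \<alpha> F) \<longleftrightarrow>
    (\<forall>x\<in>carrier A. \<exists>F \<alpha>. finite F \<and> F \<subseteq> J \<and> \<alpha> \<in> F \<rightarrow> carrier R \<and> x \<ominus>\<^bsub>A\<^esub> ?s \<alpha> F \<in> ?P)"
    by (simp only: carr ball_simps e simp_thms cong: ball_cong conj_cong)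
  show ?thesis unfolding module_basis_def using 1 2 3 by simp
qed

section \<open>Topological sums expressed by congruences\<close>

text \<open>Convergence of the finite partial sums, spelled out with congruences and with sums taken
  in A. As no particular I^n is built in, expansions inside I^n and expansions in all of A become
  directly comparable.\<close>

definition adic_sum :: "('i \<Rightarrow> 'a) \<Rightarrow> 'i set \<Rightarrow> 'a \<Rightarrow> bool"
  where "adic_sum x J m \<longleftrightarrow> (\<forall>k. \<exists>F. finite F \<and> F \<subseteq> J \<and>
    (\<forall>F'. finite F' \<and> F \<subseteq> F' \<and> F' \<subseteq> J \<longrightarrow> finsum A x F' \<ominus>\<^bsub>A\<^esub> m \<in> aug_power R A \<epsilon> k))"

text \<open>The cosets I^k + m are open, and every open set around m contains one of them, so they
  suffice to test convergence to m.\<close>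

lemma limitin_adic_topology:
  assumes "m \<in> carrier A" "\<And>y. f y \<in> carrier A"
  shows "limitin (adic_topology R A \<epsilon>) f m \<F> \<longleftrightarrow>
    (\<forall>k. \<forall>\<^sub>F y in \<F>. f y \<ominus>\<^bsub>A\<^esub> m \<in> aug_power R A \<epsilon> k)"
proof
  assume L: "limitin (adic_topology R A \<epsilon>) f m \<F>"
  show "\<forall>k. \<forall>\<^sub>F y in \<F>. f y \<ominus>\<^bsub>A\<^esub> m \<in> aug_power R A \<epsilon> k"
  proof
    fix k
    have "m \<in> aug_power R A \<epsilon> k +>\<^bsub>A\<^esub> m"
      using assms(1) by (simp add: mem_aug_coset_iff zero_in_aug_power a_minus_def M.r_neg)
    then have "\<forall>\<^sub>F y in \<F>. f y \<in> aug_power R A \<epsilon> k +>\<^bsub>A\<^esub> m"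
      using L openin_aug_coset[OF assms(1)] unfolding limitin_def by blast
    then show "\<forall>\<^sub>F y in \<F>. f y \<ominus>\<^bsub>A\<^esub> m \<in> aug_power R A \<epsilon> k"
      using assms by (simp add: mem_aug_coset_iff)
  qed
next
  assume E: "\<forall>k. \<forall>\<^sub>F y in \<F>. f y \<ominus>\<^bsub>A\<^esub> m \<in> aug_power R A \<epsilon> k"
  show "limitin (adic_topology R A \<epsilon>) f m \<F>"
    unfolding limitin_def topspace_adic_topology
  proof (intro conjI allI impI)
    fix U assume "openin (adic_topology R A \<epsilon>) U \<and> m \<in> U"
    then obtain k where k: "aug_power R A \<epsilon> k +>\<^bsub>A\<^esub> m \<subseteq> U"
      unfolding openin_adic_topology by blast
    show "\<forall>\<^sub>F y in \<F>. f y \<in> U"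
      by (rule eventually_mono[OF E[rule_format, of k]])
        (use k assms mem_aug_coset_iff in blast)
  qed (fact assms(1))
qed

lemma has_topological_sum_aug_power_iff:
  assumes "x \<in> J \<rightarrow> aug_power R A \<epsilon> n" "m \<in> aug_power R A \<epsilon> n"
  shows "has_topological_sum (A\<lparr>carrier := aug_power R A \<epsilon> n\<rparr>)
      (subtopology (adic_topology R A \<epsilon>) (aug_power R A \<epsilon> n)) x J m \<longleftrightarrow> adic_sum x J m"
proof -
  let ?P = "aug_power R A \<epsilon> n" and ?\<F> = "finite_subsets_at_top J"
  \<comment> \<open>Partial sums are replaced by zero away from the finite subsets of J, since
    \<open>limitin_adic_topology\<close> asks for values in A at every argument. The filter is
    concentrated on the finite subsets of J, so limits are unaffected.\<close>
  let ?f = "\<lambda>F. if finite F \<and> F \<subseteq> J then finsum A x F else \<zero>\<^bsub>A\<^esub>"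
  have fP: "?f F \<in> ?P" for F
    using assms(1) by (auto intro!: finsum_in_aug_power simp: zero_in_aug_power)
  have mA: "m \<in> carrier A" using assms(2) by (rule aug_power_closed)
  have ev: "\<forall>\<^sub>F F in ?\<F>. finsum (A\<lparr>carrier := ?P\<rparr>) x F = ?f F"
    unfolding eventually_finite_subsets_at_top
    by (rule exI[of _ "{}"]) (use assms(1) in \<open>auto intro!: finsum_aug_power\<close>)
  then have ev': "\<forall>\<^sub>F F in ?\<F>. ?f F = finsum (A\<lparr>carrier := ?P\<rparr>) x F"
    by (rule eventually_mono) (rule sym)
  have "limitin (subtopology (adic_topology R A \<epsilon>) ?P) (finsum (A\<lparr>carrier := ?P\<rparr>) x) m ?\<F> \<longleftrightarrow>
      limitin (subtopology (adic_topology R A \<epsilon>) ?P) ?f m ?\<F>"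
    by (rule iffI) (erule limitin_transform_eventually[OF ev] limitin_transform_eventually[OF ev'])+
  also have "\<dots> \<longleftrightarrow> limitin (adic_topology R A \<epsilon>) ?f m ?\<F>"
    using assms(2) fP by (simp add: limitin_subtopology)
  also have "\<dots> \<longleftrightarrow> (\<forall>k. \<forall>\<^sub>F F in ?\<F>. ?f F \<ominus>\<^bsub>A\<^esub> m \<in> aug_power R A \<epsilon> k)"
    by (rule limitin_adic_topology[OF mA aug_power_closed[OF fP]])
  also have "\<dots> \<longleftrightarrow> adic_sum x J m"
    unfolding adic_sum_def eventually_finite_subsets_at_top by (simp cong: conj_cong imp_cong)
  finally show ?thesis
    using assms(1) by (simp add: has_topological_sum_def)
qed

text \<open>Padding with zeros does not change a sum: a finite subset of K is cut down to J, which
  discards vanishing terms and keeps the finite set chosen for the original family. With K = J it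
  also allows a family to be altered outside J.\<close>

lemma adic_sum_mono_neutral_cong:
  assumes "adic_sum x J m" "J \<subseteq> K" "y \<in> J \<rightarrow> carrier A"
    and "\<And>i. i \<in> K - J \<Longrightarrow> y i = \<zero>\<^bsub>A\<^esub>" "\<And>i. i \<in> J \<Longrightarrow> x i = y i"
  shows "adic_sum y K m"
  unfolding adic_sum_def
proof
  fix k
  obtain F where F: "finite F" "F \<subseteq> J"
    "\<And>F'. finite F' \<Longrightarrow> F \<subseteq> F' \<Longrightarrow> F' \<subseteq> J \<Longrightarrow> finsum A x F' \<ominus>\<^bsub>A\<^esub> m \<in> aug_power R A \<epsilon> k"
    using assms(1) unfolding adic_sum_def by meson
  have "finsum A y F' \<ominus>\<^bsub>A\<^esub> m \<in> aug_power R A \<epsilon> k" if F': "finite F'" "F \<subseteq> F'" "F' \<subseteq> K" for F'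
  proof -
    have "y i \<in> carrier A" if "i \<in> F'" for i
      using that F'(3) assms(3,4) by (cases "i \<in> J") auto
    then have "finsum A x (F' \<inter> J) = finsum A y F'"
      using F' assms(4,5) by (intro M.add.finprod_mono_neutral_cong_left) auto
    then show ?thesis using F(3)[of "F' \<inter> J"] F F' by auto
  qed
  then show "\<exists>F. finite F \<and> F \<subseteq> K \<and> (\<forall>F'. finite F' \<and> F \<subseteq> F' \<and> F' \<subseteq> K \<longrightarrow>
      finsum A y F' \<ominus>\<^bsub>A\<^esub> m \<in> aug_power R A \<epsilon> k)"
    using F(1,2) assms(2) by blast
qed

lemma adic_sum_finite:
  assumes "finite J" "x \<in> J \<rightarrow> carrier A"
  shows "adic_sum x J (finsum A x J)"
  unfolding adic_sum_def
proof
  fix k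
  have "finsum A x J \<ominus>\<^bsub>A\<^esub> finsum A x J = \<zero>\<^bsub>A\<^esub>"
    using assms(2) by (simp add: M.finsum_closed a_minus_def M.r_neg)
  then show "\<exists>F. finite F \<and> F \<subseteq> J \<and> (\<forall>F'. finite F' \<and> F \<subseteq> F' \<and> F' \<subseteq> J \<longrightarrow>
      finsum A x F' \<ominus>\<^bsub>A\<^esub> finsum A x J \<in> aug_power R A \<epsilon> k)"
    using assms(1) zero_in_aug_power by (intro exI[of _ J]) auto
qed

lemma topological_basis_family_aug_power_iff:
  assumes "b \<in> J \<rightarrow> aug_power R A \<epsilon> n"
  shows "topological_basis_family R (A\<lparr>carrier := aug_power R A \<epsilon> n\<rparr>)
      (subtopology (adic_topology R A \<epsilon>) (aug_power R A \<epsilon> n)) J b \<longleftrightarrow>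
    (\<forall>m\<in>aug_power R A \<epsilon> n. \<exists>!\<alpha>. \<alpha> \<in> J \<rightarrow>\<^sub>E carrier R \<and> adic_sum (\<lambda>i. \<alpha> i \<odot>\<^bsub>A\<^esub> b i) J m)"
proof -
  have eq: "\<alpha> \<in> J \<rightarrow>\<^sub>E carrier R \<and> has_topological_sum (A\<lparr>carrier := aug_power R A \<epsilon> n\<rparr>)
        (subtopology (adic_topology R A \<epsilon>) (aug_power R A \<epsilon> n)) (\<lambda>i. \<alpha> i \<odot>\<^bsub>A\<^esub> b i) J m \<longleftrightarrow>
      \<alpha> \<in> J \<rightarrow>\<^sub>E carrier R \<and> adic_sum (\<lambda>i. \<alpha> i \<odot>\<^bsub>A\<^esub> b i) J m"
    if "m \<in> aug_power R A \<epsilon> n" for m \<alpha>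
    using that assms
    by (intro conj_cong refl has_topological_sum_aug_power_iff) (auto intro!: smult_in_aug_power)
  have "smult (A\<lparr>carrier := aug_power R A \<epsilon> n\<rparr>) = smult A"
    "carrier (A\<lparr>carrier := aug_power R A \<epsilon> n\<rparr>) = aug_power R A \<epsilon> n" by simp_all
  then show ?thesis
    using assms by (simp only: topological_basis_family_def eq simp_thms cong: ball_cong)
qed

section \<open>Existence and uniqueness of expansions for an I-adic basis\<close>

text \<open>Write I_k for \<open>outside_power\<close> at level k. An index of J outside I_k has its
  basis element in I^k, so its term is invisible modulo I^k.\<close>

lemma lincomb_outside_power_cong:
  assumes "finite F" "F \<subseteq> J" "b \<in> J \<rightarrow> carrier A" "\<alpha> \<in> F \<rightarrow> carrier R"
  shows "(\<Oplus>\<^bsub>A\<^esub>i\<in>F. \<alpha> i \<odot>\<^bsub>A\<^esub> b i)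
      \<ominus>\<^bsub>A\<^esub> (\<Oplus>\<^bsub>A\<^esub>i\<in>F \<inter> outside_power R A \<epsilon> J b k. \<alpha> i \<odot>\<^bsub>A\<^esub> b i) \<in> aug_power R A \<epsilon> k"
proof -
  let ?O = "outside_power R A \<epsilon> J b k"
  \<comment> \<open>Setting the discarded terms to zero lets both sums range over F, so that they
    can be compared term by term.\<close>
  let ?g = "\<lambda>i. if i \<in> ?O then \<alpha> i \<odot>\<^bsub>A\<^esub> b i else \<zero>\<^bsub>A\<^esub>"
  have c: "\<alpha> i \<odot>\<^bsub>A\<^esub> b i \<in> carrier A" if "i \<in> F" for i using assms that by auto
  have "(\<Oplus>\<^bsub>A\<^esub>i\<in>F \<inter> ?O. \<alpha> i \<odot>\<^bsub>A\<^esub> b i) = finsum A ?g F"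
    using assms(1) c by (intro M.add.finprod_mono_neutral_cong_left) auto
  moreover have "(\<Oplus>\<^bsub>A\<^esub>i\<in>F. \<alpha> i \<odot>\<^bsub>A\<^esub> b i) \<ominus>\<^bsub>A\<^esub> finsum A ?g F \<in> aug_power R A \<epsilon> k"
  proof (rule finsum_cong_aug_power)
    fix i assume i: "i \<in> F"
    have "\<alpha> i \<odot>\<^bsub>A\<^esub> b i \<in> aug_power R A \<epsilon> k" if "i \<notin> ?O"
      using i that assms by (intro smult_in_aug_power) (auto simp: outside_power_def)
    then show "\<alpha> i \<odot>\<^bsub>A\<^esub> b i \<ominus>\<^bsub>A\<^esub> ?g i \<in> aug_power R A \<epsilon> k"
      using c[OF i] by (auto simp: a_minus_def M.r_neg zero_in_aug_power)
  qed (use assms c in auto)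
  ultimately show ?thesis by simp
qed

text \<open>The finite set may contain indices outside I_k: their terms are dropped modulo I^k, and
  the basis of A / I^k then kills the remaining coefficients.\<close>

lemma I_adic_basis_independent:
  assumes "I_adic_basis R A \<epsilon> J b" "b \<in> J \<rightarrow> carrier A"
    and F: "finite F" "F \<subseteq> J" and \<alpha>: "\<alpha> \<in> F \<rightarrow> carrier R"
    and "(\<Oplus>\<^bsub>A\<^esub>i\<in>F. \<alpha> i \<odot>\<^bsub>A\<^esub> b i) \<in> aug_power R A \<epsilon> k"
    and "i \<in> F" "i \<in> outside_power R A \<epsilon> J b k"
  shows "\<alpha> i = \<zero>\<^bsub>R\<^esub>"
proof -
  let ?O = "outside_power R A \<epsilon> J b k"
  have bO: "b \<in> ?O \<rightarrow> carrier A" using assms(2) by (auto simp: outside_power_def)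
  have c: "\<alpha> i \<odot>\<^bsub>A\<^esub> b i \<in> carrier A" if "i \<in> F" for i using F \<alpha> assms(2) that by auto
  then have "(\<Oplus>\<^bsub>A\<^esub>i\<in>F \<inter> ?O. \<alpha> i \<odot>\<^bsub>A\<^esub> b i) \<in> aug_power R A \<epsilon> k"
    using minus_aug_power_iff[OF lincomb_outside_power_cong[OF F assms(2) \<alpha>]] assms(6)
    by (auto intro: M.finsum_closed)
  moreover have "finite (F \<inter> ?O)" "F \<inter> ?O \<subseteq> ?O" "\<alpha> \<in> F \<inter> ?O \<rightarrow> carrier R"
    using F \<alpha> by auto
  moreover have "module_basis R (quot_algebra A (aug_power R A \<epsilon> k)) ?O (\<lambda>i. aug_power R A \<epsilon> k +>\<^bsub>A\<^esub> b i)"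
    using assms(1) unfolding I_adic_basis_def by blast
  ultimately have "\<forall>i\<in>F \<inter> ?O. \<alpha> i = \<zero>\<^bsub>R\<^esub>"
    unfolding module_basis_quot_algebra_iff[OF bO] by blast
  then show ?thesis using assms(7,8) by blast
qed

lemma I_adic_basis_coeff_unique:
  assumes "I_adic_basis R A \<epsilon> J b" "b \<in> J \<rightarrow> carrier A"
    and F: "finite F" "F \<subseteq> J" and \<alpha>: "\<alpha> \<in> F \<rightarrow> carrier R" and \<beta>: "\<beta> \<in> F \<rightarrow> carrier R"
    and "x \<in> carrier A"
    and "(\<Oplus>\<^bsub>A\<^esub>i\<in>F. \<alpha> i \<odot>\<^bsub>A\<^esub> b i) \<ominus>\<^bsub>A\<^esub> x \<in> aug_power R A \<epsilon> k"
    and "(\<Oplus>\<^bsub>A\<^esub>i\<in>F. \<beta> i \<odot>\<^bsub>A\<^esub> b i) \<ominus>\<^bsub>A\<^esub> x \<in> aug_power R A \<epsilon> k"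
    and i: "i \<in> F" "i \<in> outside_power R A \<epsilon> J b k"
  shows "\<alpha> i = \<beta> i"
proof -
  have bF: "b \<in> F \<rightarrow> carrier A" using F assms(2) by auto
  have c: "(\<Oplus>\<^bsub>A\<^esub>i\<in>F. \<alpha> i \<odot>\<^bsub>A\<^esub> b i) \<in> carrier A" "(\<Oplus>\<^bsub>A\<^esub>i\<in>F. \<beta> i \<odot>\<^bsub>A\<^esub> b i) \<in> carrier A"
    using \<alpha> \<beta> bF by (auto intro!: M.finsum_closed)
  have "(\<Oplus>\<^bsub>A\<^esub>i\<in>F. \<alpha> i \<odot>\<^bsub>A\<^esub> b i) \<ominus>\<^bsub>A\<^esub> (\<Oplus>\<^bsub>A\<^esub>i\<in>F. \<beta> i \<odot>\<^bsub>A\<^esub> b i) \<in> aug_power R A \<epsilon> k"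
    using minus_aug_power_trans[OF assms(8) minus_aug_power_sym[OF assms(9)]] c assms(7) by blast
  then have "(\<Oplus>\<^bsub>A\<^esub>i\<in>F. (\<alpha> i \<ominus>\<^bsub>R\<^esub> \<beta> i) \<odot>\<^bsub>A\<^esub> b i) \<in> aug_power R A \<epsilon> k"
    using finsum_lincomb_minus[OF F(1) \<alpha> \<beta> bF] by simp
  then have "\<alpha> i \<ominus>\<^bsub>R\<^esub> \<beta> i = \<zero>\<^bsub>R\<^esub>"
    using \<alpha> \<beta> i by (intro I_adic_basis_independent[OF assms(1,2) F]) auto
  moreover have "\<alpha> i \<in> carrier R" "\<beta> i \<in> carrier R" using \<alpha> \<beta> i by auto
  moreover from this have "\<alpha> i = (\<alpha> i \<ominus>\<^bsub>R\<^esub> \<beta> i) \<oplus>\<^bsub>R\<^esub> \<beta> i" by algebra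
  ultimately show ?thesis by simp
qed

lemma I_adic_basis_adic_sum_unique:
  assumes "I_adic_basis R A \<epsilon> J b" "b \<in> J \<rightarrow> carrier A" "K \<subseteq> J"
    and \<alpha>: "\<alpha> \<in> K \<rightarrow> carrier R" and \<beta>: "\<beta> \<in> K \<rightarrow> carrier R"
    and "m \<in> carrier A"
    and "adic_sum (\<lambda>i. \<alpha> i \<odot>\<^bsub>A\<^esub> b i) K m" "adic_sum (\<lambda>i. \<beta> i \<odot>\<^bsub>A\<^esub> b i) K m"
    and i: "i \<in> K" "i \<in> outside_power R A \<epsilon> J b k"
  shows "\<alpha> i = \<beta> i"
proof -
  obtain F where F: "finite F" "F \<subseteq> K"
    "\<And>F'. finite F' \<Longrightarrow> F \<subseteq> F' \<Longrightarrow> F' \<subseteq> K \<Longrightarrow>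
      (\<Oplus>\<^bsub>A\<^esub>i\<in>F'. \<alpha> i \<odot>\<^bsub>A\<^esub> b i) \<ominus>\<^bsub>A\<^esub> m \<in> aug_power R A \<epsilon> k"
    using assms(7) unfolding adic_sum_def by meson
  obtain G where G: "finite G" "G \<subseteq> K"
    "\<And>F'. finite F' \<Longrightarrow> G \<subseteq> F' \<Longrightarrow> F' \<subseteq> K \<Longrightarrow>
      (\<Oplus>\<^bsub>A\<^esub>i\<in>F'. \<beta> i \<odot>\<^bsub>A\<^esub> b i) \<ominus>\<^bsub>A\<^esub> m \<in> aug_power R A \<epsilon> k"
    using assms(8) unfolding adic_sum_def by meson
  \<comment> \<open>One finite set on which both partial sums agree with m modulo I^k and which
    contains i, so that uniqueness at level k applies to the coefficient at i.\<close>
  let ?H = "insert i (F \<union> G)"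
  have H: "finite ?H" "F \<subseteq> ?H" "G \<subseteq> ?H" "?H \<subseteq> K" using F G i by auto
  show ?thesis
    using H assms(3,6) \<alpha> \<beta> i F(3)[OF H(1,2,4)] G(3)[OF H(1,3,4)]
    by (intro I_adic_basis_coeff_unique[OF assms(1,2), of ?H \<alpha> \<beta> m k i]) auto
qed

text \<open>The coefficient at i is read off at the first level where i is visible. As x lies in
  I^n, the coefficients at I_n vanish, which is why the sum may run over the remaining
  indices.\<close>

lemma I_adic_basis_adic_sum_exists:
  assumes basis: "I_adic_basis R A \<epsilon> J b" and b: "b \<in> J \<rightarrow> carrier A"
    and x: "x \<in> aug_power R A \<epsilon> n"
  obtains \<alpha> where "\<And>i. \<alpha> i \<in> carrier R"
    "adic_sum (\<lambda>i. \<alpha> i \<odot>\<^bsub>A\<^esub> b i) (J - outside_power R A \<epsilon> J b n) x"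
proof -
  let ?O = "outside_power R A \<epsilon> J b"
  have xA: "x \<in> carrier A" using x by (rule aug_power_closed)
  have OJ: "?O k \<subseteq> J" for k by (auto simp: outside_power_def)
  \<comment> \<open>The coefficients at level k are made total and zero off F, so approximations
    from different levels can be summed over a common index set.\<close>
  define Q where "Q k F \<gamma> \<longleftrightarrow>
      finite F \<and> F \<subseteq> ?O k \<and> (\<forall>i. \<gamma> i \<in> carrier R) \<and> (\<forall>i. i \<notin> F \<longrightarrow> \<gamma> i = \<zero>\<^bsub>R\<^esub>) \<and>
      (\<Oplus>\<^bsub>A\<^esub>i\<in>F. \<gamma> i \<odot>\<^bsub>A\<^esub> b i) \<ominus>\<^bsub>A\<^esub> x \<in> aug_power R A \<epsilon> k" for k F \<gamma>
  have "\<exists>F \<gamma>. Q k F \<gamma>" for k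
  proof -
    have bO: "b \<in> ?O k \<rightarrow> carrier A" using b OJ by auto
    have "module_basis R (quot_algebra A (aug_power R A \<epsilon> k)) (?O k) (\<lambda>i. aug_power R A \<epsilon> k +>\<^bsub>A\<^esub> b i)"
      using basis unfolding I_adic_basis_def by blast
    then obtain F \<gamma> where F: "finite F" "F \<subseteq> ?O k" "\<gamma> \<in> F \<rightarrow> carrier R"
        "x \<ominus>\<^bsub>A\<^esub> (\<Oplus>\<^bsub>A\<^esub>i\<in>F. \<gamma> i \<odot>\<^bsub>A\<^esub> b i) \<in> aug_power R A \<epsilon> k"
      unfolding module_basis_quot_algebra_iff[OF bO] using xA by meson
    let ?\<gamma> = "\<lambda>i. if i \<in> F then \<gamma> i else \<zero>\<^bsub>R\<^esub>"
    have c: "\<gamma> i \<odot>\<^bsub>A\<^esub> b i \<in> carrier A" if "i \<in> F" for i using F bO that by auto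
    have "(\<Oplus>\<^bsub>A\<^esub>i\<in>F. ?\<gamma> i \<odot>\<^bsub>A\<^esub> b i) = (\<Oplus>\<^bsub>A\<^esub>i\<in>F. \<gamma> i \<odot>\<^bsub>A\<^esub> b i)"
      using c by (intro M.finsum_cong') auto
    moreover have "(\<Oplus>\<^bsub>A\<^esub>i\<in>F. \<gamma> i \<odot>\<^bsub>A\<^esub> b i) \<ominus>\<^bsub>A\<^esub> x \<in> aug_power R A \<epsilon> k"
      using F(4) xA c by (auto intro!: minus_aug_power_sym[OF F(4)] M.finsum_closed)
    ultimately have "(\<Oplus>\<^bsub>A\<^esub>i\<in>F. ?\<gamma> i \<odot>\<^bsub>A\<^esub> b i) \<ominus>\<^bsub>A\<^esub> x \<in> aug_power R A \<epsilon> k"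
      by (simp only:)
    moreover have "\<forall>i. ?\<gamma> i \<in> carrier R" "\<forall>i. i \<notin> F \<longrightarrow> ?\<gamma> i = \<zero>\<^bsub>R\<^esub>" using F(3) by auto
    ultimately show ?thesis unfolding Q_def using F(1,2) by (intro exI[of _ F] exI[of _ ?\<gamma>] conjI)
  qed
  then obtain F \<gamma> where "\<And>k. Q k (F k) (\<gamma> k)" by metis
  then have F: "\<And>k. finite (F k)" "\<And>k. F k \<subseteq> ?O k"
    and \<gamma>: "\<And>k i. \<gamma> k i \<in> carrier R" "\<And>k i. i \<notin> F k \<Longrightarrow> \<gamma> k i = \<zero>\<^bsub>R\<^esub>"
    and sum: "\<And>k. (\<Oplus>\<^bsub>A\<^esub>i\<in>F k. \<gamma> k i \<odot>\<^bsub>A\<^esub> b i) \<ominus>\<^bsub>A\<^esub> x \<in> aug_power R A \<epsilon> k"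
    unfolding Q_def by blast+
  have c: "r \<odot>\<^bsub>A\<^esub> b i \<in> carrier A" if "r \<in> carrier R" "i \<in> J" for r i using b that by auto
  have sum_mono: "(\<Oplus>\<^bsub>A\<^esub>i\<in>G. \<gamma> k i \<odot>\<^bsub>A\<^esub> b i) = (\<Oplus>\<^bsub>A\<^esub>i\<in>F k. \<gamma> k i \<odot>\<^bsub>A\<^esub> b i)"
    if "finite G" "F k \<subseteq> G" "G \<subseteq> J" for G k
    using that b \<gamma> c F OJ by (intro M.add.finprod_mono_neutral_cong_right) (auto simp: Pi_iff subset_iff)
  \<comment> \<open>Since I^m is contained in I^k, the approximation at level m is also one at level
    k, and coefficients at I_k are unique there.\<close>
  have compat: "\<gamma> k i = \<gamma> m i" if km: "k \<le> m" and i: "i \<in> ?O k" for k m i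
  proof -
    let ?G = "insert i (F k \<union> F m)"
    have G: "finite ?G" "?G \<subseteq> J" "F k \<subseteq> ?G" "F m \<subseteq> ?G"
      using F(1)[of k] F(1)[of m] F(2)[of k] F(2)[of m] OJ[of k] OJ[of m] i by auto
    have "(\<Oplus>\<^bsub>A\<^esub>i\<in>?G. \<gamma> k i \<odot>\<^bsub>A\<^esub> b i) \<ominus>\<^bsub>A\<^esub> x \<in> aug_power R A \<epsilon> k"
      unfolding sum_mono[OF G(1,3,2)] by (rule sum)
    moreover have "(\<Oplus>\<^bsub>A\<^esub>i\<in>?G. \<gamma> m i \<odot>\<^bsub>A\<^esub> b i) \<ominus>\<^bsub>A\<^esub> x \<in> aug_power R A \<epsilon> k"
      unfolding sum_mono[OF G(1,4,2)] using sum[of m] aug_power_antimono[OF km] by blast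
    ultimately show ?thesis
      using \<gamma>(1) by (intro I_adic_basis_coeff_unique[OF basis b G(1,2) _ _ xA _ _ _ i]) auto
  qed
  \<comment> \<open>The approximation at level n is congruent to x, hence lies in I^n, and
    independence modulo I^n forces its coefficients to be zero.\<close>
  have vanish: "\<gamma> n i = \<zero>\<^bsub>R\<^esub>" if i: "i \<in> ?O n" for i
  proof (cases "i \<in> F n")
    case True
    have s: "(\<Oplus>\<^bsub>A\<^esub>i\<in>F n. \<gamma> n i \<odot>\<^bsub>A\<^esub> b i) \<in> aug_power R A \<epsilon> n"
    proof (subst minus_aug_power_iff[OF sum _ xA])
      show "(\<Oplus>\<^bsub>A\<^esub>i\<in>F n. \<gamma> n i \<odot>\<^bsub>A\<^esub> b i) \<in> carrier A"
        using c[OF \<gamma>(1)] F(2) OJ by (intro M.finsum_closed) blast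
    qed (fact x)
    show ?thesis
      by (rule I_adic_basis_independent[OF basis b F(1)[of n] _ _ s True i]) (use F OJ \<gamma> in blast)+
  qed (simp add: \<gamma>)
  \<comment> \<open>For an index lying in no I_k the \<open>LEAST\<close> is unspecified, but the
    value is still in R because every \<open>\<gamma> k i\<close> is.\<close>
  define \<alpha> where "\<alpha> i = \<gamma> (LEAST k. i \<in> ?O k) i" for i
  have \<alpha>\<gamma>: "\<alpha> i = \<gamma> k i" if "i \<in> ?O k" for k i
    unfolding \<alpha>_def
    by (rule compat[OF Least_le LeastI[where P = "\<lambda>k. i \<in> ?O k"]]) (fact that)+
  show thesis
  proof (rule that[of \<alpha>])
    show \<alpha>R: "\<alpha> i \<in> carrier R" for i unfolding \<alpha>_def by (rule \<gamma>)
    show "adic_sum (\<lambda>i. \<alpha> i \<odot>\<^bsub>A\<^esub> b i) (J - ?O n) x"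
      unfolding adic_sum_def
    proof
      fix k
      have "(\<Oplus>\<^bsub>A\<^esub>i\<in>G. \<alpha> i \<odot>\<^bsub>A\<^esub> b i) \<ominus>\<^bsub>A\<^esub> x \<in> aug_power R A \<epsilon> k"
        if G: "finite G" "F k - ?O n \<subseteq> G" "G \<subseteq> J - ?O n" for G
      proof -
        have GJ: "G \<subseteq> J" using G by auto
        \<comment> \<open>Modulo I^k only the indices in I_k count. Enlarging the set by
          \<open>F k\<close> adds only indices of \<open>F k\<close> outside G; these lie in I_n by
          the choice of G, and there the coefficients vanish.\<close>
        have "(\<Oplus>\<^bsub>A\<^esub>i\<in>G \<inter> ?O k. \<alpha> i \<odot>\<^bsub>A\<^esub> b i) = (\<Oplus>\<^bsub>A\<^esub>i\<in>(G \<inter> ?O k) \<union> F k. \<gamma> k i \<odot>\<^bsub>A\<^esub> b i)"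
        proof (rule M.add.finprod_mono_neutral_cong_left)
          fix i assume i: "i \<in> (G \<inter> ?O k) \<union> F k - G \<inter> ?O k"
          then have i': "i \<in> F k" "i \<in> ?O n" "i \<in> ?O k" "i \<in> J" using G F OJ by blast+
          \<comment> \<open>Both sides equal \<open>\<alpha> i\<close>, so it does not matter which
            of k and n is larger.\<close>
          have "\<gamma> k i = \<gamma> n i" using \<alpha>\<gamma>[OF i'(2)] \<alpha>\<gamma>[OF i'(3)] by simp
          then have "\<gamma> k i = \<zero>\<^bsub>R\<^esub>" using vanish[OF i'(2)] by simp
          then show "\<gamma> k i \<odot>\<^bsub>A\<^esub> b i = \<zero>\<^bsub>A\<^esub>" using smult_l_null[OF funcset_mem[OF b i'(4)]] by simp
        next
          show "(\<lambda>i. \<gamma> k i \<odot>\<^bsub>A\<^esub> b i) \<in> (G \<inter> ?O k) \<union> F k \<rightarrow> carrier A"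
            using c[OF \<gamma>(1)] GJ F(2)[of k] OJ[of k] by blast
        qed (use G(1) F(1) \<alpha>\<gamma> in auto)
        also have "\<dots> = (\<Oplus>\<^bsub>A\<^esub>i\<in>F k. \<gamma> k i \<odot>\<^bsub>A\<^esub> b i)"
          using G F OJ by (intro sum_mono) blast+
        finally have "(\<Oplus>\<^bsub>A\<^esub>i\<in>G \<inter> ?O k. \<alpha> i \<odot>\<^bsub>A\<^esub> b i) \<ominus>\<^bsub>A\<^esub> x \<in> aug_power R A \<epsilon> k"
          using sum by simp
        moreover have "(\<Oplus>\<^bsub>A\<^esub>i\<in>G. \<alpha> i \<odot>\<^bsub>A\<^esub> b i) \<ominus>\<^bsub>A\<^esub> (\<Oplus>\<^bsub>A\<^esub>i\<in>G \<inter> ?O k. \<alpha> i \<odot>\<^bsub>A\<^esub> b i) \<in> aug_power R A \<epsilon> k"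
          using \<alpha>R by (intro lincomb_outside_power_cong[OF G(1) GJ b]) auto
        moreover have "(\<Oplus>\<^bsub>A\<^esub>i\<in>H. \<alpha> i \<odot>\<^bsub>A\<^esub> b i) \<in> carrier A" if "H \<subseteq> G" for H
          using that GJ c[OF \<alpha>R] by (intro M.finsum_closed) blast
        ultimately show ?thesis
          using minus_aug_power_trans xA by (meson Int_lower1 subset_refl)
      qed
      then show "\<exists>F. finite F \<and> F \<subseteq> J - ?O n \<and> (\<forall>G. finite G \<and> F \<subseteq> G \<and> G \<subseteq> J - ?O n \<longrightarrow>
          (\<Oplus>\<^bsub>A\<^esub>i\<in>G. \<alpha> i \<odot>\<^bsub>A\<^esub> b i) \<ominus>\<^bsub>A\<^esub> x \<in> aug_power R A \<epsilon> k)"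
        using F(1)[of k] F(2)[of k] OJ[of k] by (intro exI[of _ "F k - ?O n"]) auto
    qed
  qed
qed

section \<open>From unique expansions back to bases of the quotients\<close>

text \<open>Independence modulo I^n combines existence of expansions at level n with uniqueness at
  level 0; spanning truncates an expansion from level 0.\<close>

lemma I_adic_basis_if_adic_sums:
  assumes b: "b \<in> J \<rightarrow> carrier A"
    and sums: "\<And>n m. m \<in> aug_power R A \<epsilon> n \<Longrightarrow>
      \<exists>!\<alpha>. \<alpha> \<in> (J - outside_power R A \<epsilon> J b n) \<rightarrow>\<^sub>E carrier R \<and>
        adic_sum (\<lambda>i. \<alpha> i \<odot>\<^bsub>A\<^esub> b i) (J - outside_power R A \<epsilon> J b n) m"
  shows "I_adic_basis R A \<epsilon> J b"
  unfolding I_adic_basis_def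
proof
  fix n
  let ?O = "outside_power R A \<epsilon> J b n"
  \<comment> \<open>The power at level 0 is all of A, so I_0 is empty and the hypothesis at level 0
    concerns expansions over the whole of J.\<close>
  have J: "J - outside_power R A \<epsilon> J b 0 = J" using b by (auto simp: outside_power_def)
  have sums0: "\<exists>!\<alpha>. \<alpha> \<in> J \<rightarrow>\<^sub>E carrier R \<and> adic_sum (\<lambda>i. \<alpha> i \<odot>\<^bsub>A\<^esub> b i) J m"
    if "m \<in> carrier A" for m
    using sums[of m 0] that unfolding J by simp
  have OJ: "?O \<subseteq> J" by (auto simp: outside_power_def)
  then have bO: "b \<in> ?O \<rightarrow> carrier A" using b by auto
  have c: "r \<odot>\<^bsub>A\<^esub> b i \<in> carrier A" if "r \<in> carrier R" "i \<in> J" for r i using b that by auto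
  have zero: "\<zero>\<^bsub>R\<^esub> \<odot>\<^bsub>A\<^esub> b i = \<zero>\<^bsub>A\<^esub>" if "i \<in> J" for i using b that by (intro smult_l_null) auto
  \<comment> \<open>Expansions over a subset are extended by zero within J and by
    \<open>undefined\<close> elsewhere, because uniqueness at level 0 holds among extensional
    families.\<close>
  have ext: "adic_sum (\<lambda>i. (if i \<in> J then if i \<in> K then \<alpha> i else \<zero>\<^bsub>R\<^esub> else undefined) \<odot>\<^bsub>A\<^esub> b i) J m"
    (is "adic_sum ?x J m")
    if K: "K \<subseteq> J" and \<alpha>: "\<alpha> \<in> K \<rightarrow> carrier R" and m: "adic_sum (\<lambda>i. \<alpha> i \<odot>\<^bsub>A\<^esub> b i) K m" for K \<alpha> m
    using K \<alpha> c zero by (intro adic_sum_mono_neutral_cong[OF m K]) (auto simp: subset_iff Pi_iff)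
  have ind: "\<alpha> i = \<zero>\<^bsub>R\<^esub>" if F: "finite F" "F \<subseteq> ?O" and \<alpha>: "\<alpha> \<in> F \<rightarrow> carrier R"
    and P: "(\<Oplus>\<^bsub>A\<^esub>i\<in>F. \<alpha> i \<odot>\<^bsub>A\<^esub> b i) \<in> aug_power R A \<epsilon> n" and i: "i \<in> F" for F \<alpha> i
  proof -
    let ?m = "\<Oplus>\<^bsub>A\<^esub>i\<in>F. \<alpha> i \<odot>\<^bsub>A\<^esub> b i"
    obtain \<beta> where \<beta>: "\<beta> \<in> (J - ?O) \<rightarrow>\<^sub>E carrier R" "adic_sum (\<lambda>i. \<beta> i \<odot>\<^bsub>A\<^esub> b i) (J - ?O) ?m"
      using sums[OF P] by blast
    let ?\<alpha> = "\<lambda>i. if i \<in> J then if i \<in> F then \<alpha> i else \<zero>\<^bsub>R\<^esub> else undefined"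
    let ?\<beta> = "\<lambda>i. if i \<in> J then if i \<in> J - ?O then \<beta> i else \<zero>\<^bsub>R\<^esub> else undefined"
    have FJ: "F \<subseteq> J" using F OJ by blast
    have "adic_sum (\<lambda>i. \<alpha> i \<odot>\<^bsub>A\<^esub> b i) F ?m"
      using F(1) FJ \<alpha> c by (intro adic_sum_finite) auto
    from ext[OF FJ \<alpha> this] have "adic_sum (\<lambda>i. ?\<alpha> i \<odot>\<^bsub>A\<^esub> b i) J ?m" .
    moreover have "adic_sum (\<lambda>i. ?\<beta> i \<odot>\<^bsub>A\<^esub> b i) J ?m"
      using \<beta> by (intro ext) auto
    moreover have "?\<alpha> \<in> J \<rightarrow>\<^sub>E carrier R" "?\<beta> \<in> J \<rightarrow>\<^sub>E carrier R"
      using \<alpha> \<beta>(1) by auto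
    \<comment> \<open>Two expansions of one element: the first is supported in I_n, the second off
      I_n. Their equality makes the coefficients of the first vanish.\<close>
    ultimately have "?\<alpha> = ?\<beta>" using sums0[OF aug_power_closed[OF P]] by blast
    moreover have "i \<in> ?O" "i \<in> J" using i F(2) FJ by auto
    ultimately show ?thesis using i fun_cong[of ?\<alpha> ?\<beta> i] by simp
  qed
  have span: "\<exists>F \<alpha>. finite F \<and> F \<subseteq> ?O \<and> \<alpha> \<in> F \<rightarrow> carrier R \<and>
      x \<ominus>\<^bsub>A\<^esub> (\<Oplus>\<^bsub>A\<^esub>i\<in>F. \<alpha> i \<odot>\<^bsub>A\<^esub> b i) \<in> aug_power R A \<epsilon> n" if x: "x \<in> carrier A" for x
  proof -
    obtain \<alpha> where \<alpha>: "\<alpha> \<in> J \<rightarrow>\<^sub>E carrier R" "adic_sum (\<lambda>i. \<alpha> i \<odot>\<^bsub>A\<^esub> b i) J x"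
      using sums0[OF x] by blast
    then obtain F where F: "finite F" "F \<subseteq> J"
      "(\<Oplus>\<^bsub>A\<^esub>i\<in>F. \<alpha> i \<odot>\<^bsub>A\<^esub> b i) \<ominus>\<^bsub>A\<^esub> x \<in> aug_power R A \<epsilon> n"
      unfolding adic_sum_def by blast
    have \<alpha>F: "\<alpha> \<in> F \<rightarrow> carrier R" using \<alpha>(1) F(2) by auto
    have s: "(\<Oplus>\<^bsub>A\<^esub>i\<in>G. \<alpha> i \<odot>\<^bsub>A\<^esub> b i) \<in> carrier A" if "G \<subseteq> F" for G
      using that \<alpha>F F(2) c by (intro M.finsum_closed) (auto simp: subset_iff Pi_iff)
    \<comment> \<open>The partial sum over F already agrees with x modulo I^n, and the terms at
      indices outside I_n may be dropped.\<close>
    have "x \<ominus>\<^bsub>A\<^esub> (\<Oplus>\<^bsub>A\<^esub>i\<in>F \<inter> ?O. \<alpha> i \<odot>\<^bsub>A\<^esub> b i) \<in> aug_power R A \<epsilon> n"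
      using minus_aug_power_trans[OF minus_aug_power_sym[OF F(3) s x]
          lincomb_outside_power_cong[OF F(1,2) b \<alpha>F, of n] x s s] by auto
    then show ?thesis using F(1) \<alpha>F by (intro exI[of _ "F \<inter> ?O"] exI[of _ \<alpha>]) auto
  qed
  show "module_basis R (quot_algebra A (aug_power R A \<epsilon> n)) ?O (\<lambda>i. aug_power R A \<epsilon> n +>\<^bsub>A\<^esub> b i)"
    unfolding module_basis_quot_algebra_iff[OF bO] using ind span by blast
qed

end

section \<open>Separation by the powers of I, and the equivalence\<close>

text \<open>Such an x has the same image as zero in every A / I^n, and completeness makes the
  natural map to the limit injective.\<close>

lemma (in complete_augmented_algebra) Inter_aug_power:
  assumes "\<And>n. x \<in> aug_power R A \<epsilon> n"
  shows "x = \<zero>\<^bsub>A\<^esub>"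
proof -
  have xA: "x \<in> carrier A" using assms by (rule aug_power_closed)
  have "inj_on (\<lambda>a n. aug_power R A \<epsilon> n +>\<^bsub>A\<^esub> a) (carrier A)"
    using complete by (auto simp: algebra_iso_def ring_iso_def bij_betw_def)
  moreover have "aug_power R A \<epsilon> n +>\<^bsub>A\<^esub> x = aug_power R A \<epsilon> n +>\<^bsub>A\<^esub> \<zero>\<^bsub>A\<^esub>" for n
    using xA assms by (simp add: aug_coset_eq_iff minus_in_aug_power zero_in_aug_power)
  ultimately show ?thesis using xA unfolding inj_on_def by blast
qed

text \<open>A zero member of the family lies in every I^n, so the I-adic condition does not see it,
  while its coefficient in a topological expansion is arbitrary. The third assumption excludes this,
  except over the zero ring, where there is just one coefficient.\<close>

theorem proposition2p5:
  fixes R :: "('k, 'p) ring_scheme"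
    and A :: "('k, 'a, 'q) module_scheme"
    and \<epsilon> :: "'a \<Rightarrow> 'k"
    and J :: "'i set"
    and b :: "'i \<Rightarrow> 'a"
  assumes "complete_augmented_algebra R A \<epsilon>"
    and "b \<in> J \<rightarrow> carrier A"
    and "carrier R = {\<zero>\<^bsub>R\<^esub>} \<or> (\<forall>i\<in>J. b i \<noteq> \<zero>\<^bsub>A\<^esub>)"
  shows "I_adic_basis R A \<epsilon> J b \<longleftrightarrow>
    (\<forall>n. topological_basis_family R
           (A\<lparr>carrier := aug_power R A \<epsilon> n\<rparr>)
           (subtopology (adic_topology R A \<epsilon>) (aug_power R A \<epsilon> n))
           (J - outside_power R A \<epsilon> J b n) b)"
proof -
  interpret complete_augmented_algebra R A \<epsilon> by fact
  let ?J = "\<lambda>n. J - outside_power R A \<epsilon> J b n"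
  have bJ: "b \<in> ?J n \<rightarrow> aug_power R A \<epsilon> n" for n by (auto simp: outside_power_def)
  have forward: "\<exists>!\<alpha>. \<alpha> \<in> ?J n \<rightarrow>\<^sub>E carrier R \<and> adic_sum (\<lambda>i. \<alpha> i \<odot>\<^bsub>A\<^esub> b i) (?J n) m"
    if basis: "I_adic_basis R A \<epsilon> J b" and m: "m \<in> aug_power R A \<epsilon> n" for n m
  proof -
    obtain \<alpha> where \<alpha>: "\<And>i. \<alpha> i \<in> carrier R" "adic_sum (\<lambda>i. \<alpha> i \<odot>\<^bsub>A\<^esub> b i) (?J n) m"
      using I_adic_basis_adic_sum_exists[OF basis assms(2) m] by blast
    \<comment> \<open>Restricting makes the coefficient family extensional, as the encoding of
      topological bases demands.\<close>
    have ex: "adic_sum (\<lambda>i. restrict \<alpha> (?J n) i \<odot>\<^bsub>A\<^esub> b i) (?J n) m"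
      using assms(2) \<alpha>(1) by (intro adic_sum_mono_neutral_cong[OF \<alpha>(2) subset_refl]) auto
    have "\<beta> = \<gamma>"
      if \<beta>: "\<beta> \<in> ?J n \<rightarrow>\<^sub>E carrier R" "adic_sum (\<lambda>i. \<beta> i \<odot>\<^bsub>A\<^esub> b i) (?J n) m"
        and \<gamma>: "\<gamma> \<in> ?J n \<rightarrow>\<^sub>E carrier R" "adic_sum (\<lambda>i. \<gamma> i \<odot>\<^bsub>A\<^esub> b i) (?J n) m" for \<beta> \<gamma>
    proof (rule PiE_ext[OF \<beta>(1) \<gamma>(1)])
      fix i assume i: "i \<in> ?J n"
      show "\<beta> i = \<gamma> i"
      \<comment> \<open>Uniqueness of the coefficient at i needs a level k with i in I_k. Without
        one, b_i lies in every power and so is zero, which leaves only the zero ring.\<close>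
      proof (cases "\<exists>k. i \<in> outside_power R A \<epsilon> J b k")
        case True
        then obtain k where "i \<in> outside_power R A \<epsilon> J b k" ..
        then show ?thesis
          using \<beta> \<gamma> i aug_power_closed[OF m]
          by (intro I_adic_basis_adic_sum_unique[OF basis assms(2), of "?J n" \<beta> \<gamma> m i k])
            (auto simp: PiE_iff)
      next
        case False
        then have "b i = \<zero>\<^bsub>A\<^esub>" using i by (intro Inter_aug_power) (auto simp: outside_power_def)
        then have "carrier R = {\<zero>\<^bsub>R\<^esub>}" using assms(3) i by auto
        then show ?thesis using PiE_mem[OF \<beta>(1) i] PiE_mem[OF \<gamma>(1) i] by simp
      qed
    qed
    then show ?thesis
      using ex \<alpha>(1) by (intro ex_ex1I exI[of _ "restrict \<alpha> (?J n)"]) auto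
  qed
  show ?thesis
    unfolding topological_basis_family_aug_power_iff[OF bJ]
  proof (intro iffI allI ballI)
    fix n m
    assume "I_adic_basis R A \<epsilon> J b" "m \<in> aug_power R A \<epsilon> n"
    then show "\<exists>!\<alpha>. \<alpha> \<in> ?J n \<rightarrow>\<^sub>E carrier R \<and> adic_sum (\<lambda>i. \<alpha> i \<odot>\<^bsub>A\<^esub> b i) (?J n) m"
      by (rule forward)
  next
    assume sums: "\<forall>n. \<forall>m\<in>aug_power R A \<epsilon> n. \<exists>!\<alpha>. \<alpha> \<in> ?J n \<rightarrow>\<^sub>E carrier R \<and>
      adic_sum (\<lambda>i. \<alpha> i \<odot>\<^bsub>A\<^esub> b i) (?J n) m"
    show "I_adic_basis R A \<epsilon> J b"
      by (rule I_adic_basis_if_adic_sums[OF assms(2) sums[rule_format]])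
  qed
qed

end
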